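(* Let $A$ be a finite alphabet, let $x$ be an infinite non-ultimately periodic word over $A$, let $u\in\mathrm{Fac}(x)$ with $|u|\geq 1$ be primitive and such that $u^5$ is recurrent in $x$, and let $k\geq 1$ be an integer such that $\mathrm{maxPL}(x)\leq k$. Then there is an infinite non-ultimately periodic word $\overline x$ over $A$ such that $u^5\notin\mathrm{Fac}(\overline x)$, $(u^R)^5\notin\mathrm{Fac}(\overline x)$, $\Psi(x,u)\subseteq\mathrm{Fac}(\overline x)$, and $\mathrm{maxPL}(\overline x)\leq 3k^3$.
   Context: $A$ is a finite alphabet, $A^+$ is the set of nonempty finite words over $A$. For a finite word $v=a_1a_2\cdots a_n$ (letters $a_i$), $v^R=a_n\cdots a_2a_1$ is its reversal; $v$ is a palindrome if it is nonempty and $v=v^R$. The palindromic length $\mathrm{PL}(v)$ of a nonempty finite word $v$ is the minimal number $m$ such that $v=v_1v_2\cdots v_m$ with all $v_i$ nonempty palindromes. For a finite or infinite word $y$, $\mathrm{Fac}(y)$ is the set of all finite factors (contiguous subwords) of $y$, including the empty word, and $\mathrm{maxPL}(y)=\max\{\mathrm{PL}(t)\mid t\in\mathrm{Fac}(y)\}$ ($t$ nonempty); $\mathrm{maxPL}(y)\le k$ means that every nonempty finite factor of $y$ has palindromic length at most $k$. An infinite word $x$ is ultimately periodic if $x=x_1x_2^\infty$ for some $x_1,x_2\in A^+$, and non-ultimately periodic otherwise. For a rational $q\ge 1$, a word $v$ is the $q$-power $u^q$ of $u\in A^+$ if $v=u^{\lfloor q\rfloor}\overline u$ with $\overline u$ a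 proper (possibly empty) prefix of $u$ and $|v|=q|u|$. A word $v\in A^+$ is primitive if there are no $t\in A^+$ and rational number $q\geq 2$ such that $v=t^q$, i.e. such that $v=t^{\lfloor q\rfloor}\overline t$ with $\overline t$ a proper (possibly empty) prefix of $t$ and $|v|=q|t|$. A nonempty factor is recurrent in $x$ if it has infinitely many occurrences in $x$. For an infinite word $x$ and a nonempty finite word $u$, $\Psi(x,u)=\{t\in\mathrm{Fac}(x)\mid u\notin\mathrm{Fac}(t)\text{ and }u^R\notin\mathrm{Fac}(t)\}$. *)

theory Defs
  imports
    Complex_Main
    "HOL-Library.Sublist"
    "HOL-Library.Omega_Words_Fun"
    "HOL-Library.Extended_Nat"
begin

text \<open>
  Finite words are lists; infinite words are functions on the naturals
  (\<^typ>\<open>'a word\<close> of \<^theory>\<open>HOL-Library.Omega_Words_Fun\<close>).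
  A word \<open>x\<close> over the alphabet \<open>A\<close> is one with \<open>range x \<subseteq> A\<close>.
\<close>

definition palindrome :: "'a list \<Rightarrow> bool" where
  "palindrome v \<longleftrightarrow> v \<noteq> [] \<and> v = rev v"

definition PL :: "'a list \<Rightarrow> nat" where
  "PL v = (LEAST m. \<exists>vs. length vs = m \<and> v = concat vs \<and> (\<forall>p\<in>set vs. palindrome p))"

definition fin_factors :: "'a list \<Rightarrow> 'a list set" where
  "fin_factors v = {t. sublist t v}"

definition factors :: "'a word \<Rightarrow> 'a list set" where
  "factors x = {t. \<exists>i j. t = subsequence x i j}"

text \<open>
  As a supremum in \<^typ>\<open>enat\<close>, \<open>maxPL x\<close> is the maximum if the palindromic lengths of the
  nonempty factors are bounded, and \<open>\<infinity>\<close> otherwise.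
\<close>

definition maxPL :: "'a word \<Rightarrow> enat" where
  "maxPL x = (SUP t\<in>factors x - {[]}. enat (PL t))"

lemma maxPL_le_iff:
  "maxPL x \<le> enat k \<longleftrightarrow> (\<forall>t\<in>factors x. t \<noteq> [] \<longrightarrow> PL t \<le> k)"
  by (auto simp: maxPL_def SUP_le_iff)

definition ultimately_periodic :: "'a word \<Rightarrow> bool" where
  "ultimately_periodic x \<longleftrightarrow>
     (\<exists>x\<^sub>1 x\<^sub>2. x\<^sub>1 \<noteq> [] \<and> x\<^sub>2 \<noteq> [] \<and> x = x\<^sub>1 \<frown> iter x\<^sub>2)"

definition word_power :: "'a list \<Rightarrow> nat \<Rightarrow> 'a list" where
  "word_power u n = concat (replicate n u)"

definition is_rat_power :: "'a list \<Rightarrow> 'a list \<Rightarrow> rat \<Rightarrow> bool" where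
  "is_rat_power v u q \<longleftrightarrow> u \<noteq> [] \<and> q \<ge> 1 \<and>
     (\<exists>u'. strict_prefix u' u \<and> v = word_power u (nat \<lfloor>q\<rfloor>) @ u') \<and>
     of_nat (length v) = q * of_nat (length u)"

lemma length_word_power: "length (word_power u n) = n * length u"
  by (simp add: word_power_def length_concat sum_list_replicate)

lemma is_rat_power_of_nat_iff:
  assumes "u \<noteq> []" and "n \<ge> 1"
  shows "is_rat_power v u (of_nat n) \<longleftrightarrow> v = word_power u n"
proof
  assume "is_rat_power v u (of_nat n)"
  then obtain u' where v: "v = word_power u n @ u'"
    and len: "(of_nat (length v) :: rat) = of_nat n * of_nat (length u)"
    by (auto simp: is_rat_power_def)
  from len have "length v = n * length u"
    by (metis of_nat_eq_iff of_nat_mult)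
  with v show "v = word_power u n"
    by (simp add: length_word_power)
next
  assume "v = word_power u n"
  then show "is_rat_power v u (of_nat n)"
    using assms by (auto simp: is_rat_power_def length_word_power strict_prefix_def)
qed

definition primitive :: "'a list \<Rightarrow> bool" where
  "primitive v \<longleftrightarrow> v \<noteq> [] \<and> \<not> (\<exists>t q. t \<noteq> [] \<and> q \<ge> 2 \<and> is_rat_power v t q)"

definition recurrent_in :: "'a list \<Rightarrow> 'a word \<Rightarrow> bool" where
  "recurrent_in t x \<longleftrightarrow> t \<noteq> [] \<and> infinite {i. subsequence x i (i + length t) = t}"

definition Psi :: "'a word \<Rightarrow> 'a list \<Rightarrow> 'a list set" where
  "Psi x u = {t \<in> factors x. u \<notin> fin_factors t \<and> rev u \<notin> fin_factors t}"

end

theory Submission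
  imports Defs "HOL-Library.Countable_Set" "HOL-Library.FuncSet"
begin

text \<open>
  Let \<open>p\<close> be the length of \<open>u\<close>. In every long run of period \<open>p\<close> that contains \<open>u\<close> or its
  reversal, delete a multiple of \<open>p\<close> letters so that fewer than \<open>5 p\<close> remain. Both ends of the run
  survive, so factors avoiding \<open>u\<close> and its reversal do too. A palindrome of \<open>x\<close> decomposes into a
  prefix and a suffix of period \<open>p\<close>, each leaving at most two factors of \<open>x\<close>, and a palindromic
  core that cuts no run. The runs in the core are exchanged by the reflection, and since the result
  does not depend on which part of a run is deleted, the shortened core is again a palindrome. A
  factor of the new word thus has palindromic length at most \<open>k (4 k + 1)\<close>, which is at most
  \<open>3 k\<^sup>3\<close> because \<open>k = 1\<close> would make \<open>x\<close> constant.

  For aperiodicity, each run length may be shortened to one of two values, which gives a family of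
  words indexed by sets \<open>f\<close> of lengths. If there are infinitely many run lengths, uncountably many
  different words arise, but only countably many are ultimately periodic. If there are finitely
  many and all shortened words were ultimately periodic, the pigeonhole principle would give two
  positions of \<open>x\<close> at which all of them have equal suffixes. Together these determine the
  suffixes of \<open>x\<close>, so \<open>x\<close> would be ultimately periodic.
\<close>

section \<open>Palindromic length and ultimate periodicity\<close>

lemma PL_le:
  assumes "v = concat vs" "\<forall>p\<in>set vs. palindrome p"
  shows "PL v \<le> length vs"
  unfolding PL_def using assms by (intro Least_le) blast

lemma PL_attained:
  obtains vs where "length vs = PL v" "v = concat vs" "\<forall>p\<in>set vs. palindrome p"
proof -
  have "v = concat (map (\<lambda>a. [a]) v) \<and> (\<forall>p\<in>set (map (\<lambda>a. [a]) v). palindrome p)"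
    by (auto simp: palindrome_def)
  then have "\<exists>m vs. length vs = m \<and> v = concat vs \<and> (\<forall>p\<in>set vs. palindrome p)"
    by blast
  from LeastI_ex[OF this] show ?thesis
    using that unfolding PL_def by blast
qed

lemma PL_append: "PL (v @ w) \<le> PL v + PL w"
proof -
  obtain vs where vs: "length vs = PL v" "v = concat vs" "\<forall>p\<in>set vs. palindrome p"
    by (rule PL_attained)
  obtain ws where ws: "length ws = PL w" "w = concat ws" "\<forall>p\<in>set ws. palindrome p"
    by (rule PL_attained)
  show ?thesis
    using PL_le[of "v @ w" "vs @ ws"] vs ws by auto
qed

lemma PL_Nil [simp]: "PL [] = 0"
  using PL_le[of "[]" "[]"] by simp

lemma PL_rev_eq: "v = rev v \<Longrightarrow> PL v \<le> 1"
  using PL_le[of v "[v]"] by (cases "v = []") (auto simp: palindrome_def)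

lemma ultimately_periodicI:
  assumes "0 < d" "\<And>i. n \<le> i \<Longrightarrow> x i = x (i + d)"
  shows "ultimately_periodic x"
proof -
  have mult: "x i = x (i + m * d)" if "n \<le> i" for i m
  proof (induction m)
    case (Suc m)
    then show ?case
      using assms(2)[of "i + m * d"] that by (simp add: algebra_simps)
  qed simp
  \<comment> \<open>\<open>Suc n\<close> letters instead of \<open>n\<close>: the definition asks
    for a nonempty first part even when \<open>n = 0\<close>.\<close>
  define x1 where "x1 = subsequence x 0 (Suc n)"
  define x2 where "x2 = subsequence x (Suc n) (Suc n + d)"
  have len: "length x1 = Suc n" "length x2 = d"
    by (auto simp: x1_def x2_def)
  have "x i = (x1 \<frown> iter x2) i" for i
  proof (cases "i < Suc n")
    case True
    then show ?thesis by (simp add: len conc_def x1_def subsequence_def del: upt_Suc)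
  next
    case False
    define r where "r = (i - Suc n) mod d"
    have "i = (Suc n + r) + ((i - Suc n) div d) * d"
      using False by (simp add: r_def)
    then have "x i = x (Suc n + r)"
      using mult[of "Suc n + r" "(i - Suc n) div d"] by simp
    moreover have "r < d"
      using assms(1) by (simp add: r_def)
    ultimately show ?thesis
      using False assms(1) len
      by (auto simp: conc_def iter_def x2_def subsequence_def r_def simp del: upt_Suc)
  qed
  then have "x = x1 \<frown> iter x2" by blast
  moreover have "x1 \<noteq> []" "x2 \<noteq> []"
    using len assms(1) by auto
  ultimately show ?thesis
    unfolding ultimately_periodic_def by blast
qed

lemma ultimately_periodicE:
  assumes "ultimately_periodic x"
  obtains n d where "0 < d" "\<And>i. n \<le> i \<Longrightarrow> x i = x (i + d)"
proof -
  obtain x1 x2 where x: "x1 \<noteq> []" "x2 \<noteq> []" "x = x1 \<frown> iter x2"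
    using assms unfolding ultimately_periodic_def by blast
  have "x i = x (i + length x2)" if "length x1 \<le> i" for i
  proof -
    have "i + length x2 - length x1 = (i - length x1) + length x2"
      using that by simp
    then have "(i + length x2 - length x1) mod length x2 = (i - length x1) mod length x2"
      by simp
    then show ?thesis
      using that x by (simp add: conc_def iter_def)
  qed
  then show ?thesis
    using that[of "length x2" "length x1"] x by blast
qed

text \<open>From \<open>n + d\<close> on, moving the start back by \<open>d\<close> does not change
  the suffix, so finitely many starts suffice.\<close>

lemma finite_suffixes:
  assumes "ultimately_periodic x"
  shows "finite (range (\<lambda>i. suffix i x))"
proof -
  obtain n d where d: "0 < d" "\<And>i. n \<le> i \<Longrightarrow> x i = x (i + d)"
    using assms by (rule ultimately_periodicE) blast
  have "\<exists>j<n+d. suffix i x = suffix j x" for i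
  proof (induction i rule: less_induct)
    case (less i)
    show ?case
    proof (cases "i < n + d")
      case False
      have "suffix i x = suffix (i - d) x"
      proof
        fix q
        show "suffix i x q = suffix (i - d) x q"
          using d(2)[of "i - d + q"] False by (simp add: suffix_def algebra_simps)
      qed
      then show ?thesis
        using less[of "i - d"] False d(1) by auto
    qed auto
  qed
  then have "range (\<lambda>i. suffix i x) \<subseteq> (\<lambda>i. suffix i x) ` {..<n+d}"
    by blast
  then show ?thesis
    by (meson finite_imageI finite_lessThan finite_subset)
qed

lemma countable_ultimately_periodic:
  assumes "finite A"
  shows "countable {x. range x \<subseteq> A \<and> ultimately_periodic x}"
proof -
  have "{x. range x \<subseteq> A \<and> ultimately_periodic x} \<subseteq> (\<lambda>(v, w). v \<frown> iter w) ` (lists A \<times> lists A)"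
  proof
    fix x assume "x \<in> {x. range x \<subseteq> A \<and> ultimately_periodic x}"
    then obtain v w where x: "range x \<subseteq> A" "v \<noteq> []" "w \<noteq> []" "x = v \<frown> iter w"
      unfolding ultimately_periodic_def by blast
    have "w ! i \<in> range (iter w)" if "i < length w" for i
      using that x(3) by (intro range_eqI[of _ _ i]) simp
    then have "set v \<union> set w \<subseteq> range x"
      unfolding x(4) range_conc by (auto simp: in_set_conv_nth simp del: iter_nth)
    then have "v \<in> lists A" "w \<in> lists A"
      using x(1) by auto
    then show "x \<in> (\<lambda>(v, w). v \<frown> iter w) ` (lists A \<times> lists A)"
      using x(4) by force
  qed
  moreover have "countable (lists A \<times> lists A)"
    using assms by (intro countable_SIGMA countable_lists countable_finite)
  ultimately show ?thesis
    by (meson countable_image countable_subset)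
qed

text \<open>Cantor's diagonal argument along the increasing enumeration of \<open>V\<close>.\<close>

lemma uncountable_Pow:
  assumes "infinite (V :: nat set)"
  shows "\<not> countable (Pow V)"
proof
  assume "countable (Pow V)"
  then have r: "range (from_nat_into (Pow V)) = Pow V"
    by (intro range_from_nat_into) auto
  define D where "D = {enumerate V n | n. enumerate V n \<notin> from_nat_into (Pow V) n}"
  have "D \<in> Pow V"
    using enumerate_in_set[OF assms] by (auto simp: D_def)
  then obtain n where n: "D = from_nat_into (Pow V) n"
    using r by (metis rangeE)
  have "enumerate V i = enumerate V j \<longleftrightarrow> i = j" for i j
    using strict_mono_enumerate[OF assms] by (simp add: strict_mono_eq)
  then have "enumerate V n \<in> D \<longleftrightarrow> enumerate V n \<notin> from_nat_into (Pow V) n"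
    by (auto simp: D_def)
  then have "enumerate V n \<in> D \<longleftrightarrow> enumerate V n \<notin> D"
    using n by simp
  then show False by blast
qed

section \<open>Index intervals, intervals with a gap, and powers of a word\<close>

lemma upt_split: "i \<le> m \<Longrightarrow> m \<le> j \<Longrightarrow> [i..<j] = [i..<m] @ [m..<j]"
  using upt_add_eq_append[of i m "j - m"] by simp

lemma subsequence_split:
  "i \<le> m \<Longrightarrow> m \<le> j \<Longrightarrow> subsequence x i j = subsequence x i m @ subsequence x m j"
  unfolding subsequence_def by (simp add: upt_split[of i m j])

text \<open>Computes what remains of an interval when a single block is shortened;
  \<open>min\<close> and \<open>max\<close> cover a gap that sticks out of the interval or misses
  it.\<close>

lemma filter_upt_gap:
  assumes "\<And>q. i \<le> q \<Longrightarrow> q < j \<Longrightarrow> P q \<longleftrightarrow> \<not> (l \<le> q \<and> q < r)" "l \<le> r"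
  shows "filter P [i..<j] = [i..<min j l] @ [max i r..<j]"
proof (rule sorted_distinct_set_unique)
  show "sorted (filter P [i..<j])" "distinct (filter P [i..<j])"
    by (auto simp: sorted_wrt_filter)
  show "sorted ([i..<min j l] @ [max i r..<j])" "distinct ([i..<min j l] @ [max i r..<j])"
    using assms(2) by (auto simp: sorted_append)
  show "set (filter P [i..<j]) = set ([i..<min j l] @ [max i r..<j])"
    using assms by (auto simp: not_le not_less)
qed

lemma nth_word_power:
  assumes "r < n * length v"
  shows "word_power v n ! r = v ! (r mod length v)"
  using assms
proof (induction n arbitrary: r)
  case (Suc n)
  then show ?case
    by (cases "r < length v") (auto simp: word_power_def nth_append le_mod_geq)
qed simp

lemma factor_nth:
  assumes "subsequence y i j = t" "r < length t"
  shows "y (i + r) = t ! r"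
  using assms by auto

section \<open>Shortening the runs of a word\<close>

text \<open>The second assumption makes every run of period \<open>length u\<close> finite and
  leaves infinitely many letters after the deletion. It holds for every word that is not ultimately
  periodic.\<close>

locale word_runs =
  fixes x :: "'a word" and u :: "'a list"
  assumes u_nonempty: "u \<noteq> []"
    and infinite_breaks: "infinite {i. x i \<noteq> x (i + length u)}"
begin

abbreviation p :: nat where "p \<equiv> length u"

definition agree :: "nat \<Rightarrow> bool" where
  "agree i \<longleftrightarrow> x i = x (i + p)"

text \<open>
  A block \<open>[a, c)\<close> encodes the maximal run \<open>[a, c + p)\<close> of period \<open>p\<close>. Maximal runs may overlap,
  blocks cannot.
\<close>

definition block :: "nat \<Rightarrow> nat \<Rightarrow> bool" where
  "block a c \<longleftrightarrow> a < c \<and> (\<forall>i\<in>{a..<c}. agree i) \<and> \<not> agree c \<and> (a = 0 \<or> \<not> agree (a - 1))"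

text \<open>The length \<open>3 * p\<close> leaves room for both values of \<open>red\<close>. The
  start \<open>m = c\<close> is allowed because the run reaches \<open>p\<close> letters past
  \<open>c\<close>. Admitting \<open>rev u\<close> makes the notion invariant under
  reflection.\<close>

definition long_block :: "nat \<Rightarrow> nat \<Rightarrow> bool" where
  "long_block a c \<longleftrightarrow> block a c \<and> 3 * p \<le> c - a \<and>
     (\<exists>m\<in>{a..c}. subsequence x m (m + p) \<in> {u, rev u})"

text \<open>
  Removing \<open>cut f l\<close> letters leaves a block of length \<open>red f l < 4 p\<close>. The set \<open>f\<close> encodes
  which of two lengths a block gets; it is chosen to make the shortened word aperiodic.
\<close>

definition red :: "nat set \<Rightarrow> nat \<Rightarrow> nat" where
  "red f l = 2 * p + l mod p + (if l \<in> f then p else 0)"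

definition cut :: "nat set \<Rightarrow> nat \<Rightarrow> nat" where
  "cut f l = l - red f l"

text \<open>
  The offset \<open>p\<close> keeps the deleted part inside its block after a reflection: reversing a word
  maps the run \<open>[a, c + p)\<close> to a run, but the mirror image of the block \<open>[a, c)\<close> is shifted by \<open>p\<close>.
\<close>

definition del :: "nat set \<Rightarrow> nat set" where
  "del f = {q. \<exists>a c. long_block a c \<and> a + p \<le> q \<and> q < a + p + cut f (c - a)}"

abbreviation kept :: "nat set \<Rightarrow> nat set" where
  "kept f \<equiv> - del f"

definition pos :: "nat set \<Rightarrow> nat \<Rightarrow> nat" where
  "pos f = enumerate (kept f)"

text \<open>The inverse of \<open>pos f\<close> on kept positions, but defined everywhere, so that
  the ends of any interval of \<open>x\<close> can be carried over to
  \<open>short f\<close>.\<close>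

definition idx :: "nat set \<Rightarrow> nat \<Rightarrow> nat" where
  "idx f m = length (filter (\<lambda>q. q \<in> kept f) [0..<m])"

definition short :: "nat set \<Rightarrow> 'a word" where
  "short f = x \<circ> pos f"

section \<open>Blocks and their deleted parts\<close>

lemma p_pos: "0 < p"
  using u_nonempty by simp

lemma next_break: "\<exists>w\<ge>v. \<not> agree w \<and> (\<forall>i\<in>{v..<w}. agree i)"
proof -
  have ex: "\<exists>w. v \<le> w \<and> \<not> agree w"
    using infinite_breaks unfolding infinite_nat_iff_unbounded_le agree_def by auto
  define w where "w = (LEAST w. v \<le> w \<and> \<not> agree w)"
  have "v \<le> w \<and> \<not> agree w"
    unfolding w_def using ex by (rule LeastI_ex)
  moreover have "agree i" if "i \<in> {v..<w}" for i
    using that not_less_Least[of i "\<lambda>w. v \<le> w \<and> \<not> agree w"] unfolding w_def by auto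
  ultimately show ?thesis by blast
qed

text \<open>Otherwise \<open>a' - 1\<close> would lie in \<open>[a, c)\<close>, against the
  left-maximality of \<open>a'\<close>.\<close>

lemma block_before:
  assumes "block a c" "block a' c'" "a < a'"
  shows "c < a'"
proof (rule ccontr)
  assume "\<not> c < a'"
  then have "a' - 1 \<in> {a..<c}" using assms(3) by auto
  then show False using assms unfolding block_def by auto
qed

lemma block_unique:
  assumes "block a c" "block a' c'" "a \<le> q" "q < c" "a' \<le> q" "q < c'"
  shows "a = a'" "c = c'"
proof -
  show "a = a'"
    using block_before[OF assms(1,2)] block_before[OF assms(2,1)] assms(3-6) by linarith
  then have "\<not> c < c'" "\<not> c' < c"
    using assms unfolding block_def by auto
  then show "c = c'" by simp
qed

lemma block_exists:
  assumes "agree m"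
  obtains a c where "block a c" "a \<le> m" "m < c"
proof -
  obtain c where c: "m \<le> c" "\<not> agree c" "\<forall>i\<in>{m..<c}. agree i"
    using next_break[of m] by blast
  define P where "P = (\<lambda>a. \<forall>i\<in>{a..m}. agree i)"
  define a where "a = (LEAST a. P a)"
  have "P m" using assms by (simp add: P_def)
  then have P: "P a" and am: "a \<le> m"
    unfolding a_def by (auto intro: LeastI Least_le)
  have "\<not> agree (a - 1)" if "a \<noteq> 0"
  proof
    assume ag: "agree (a - 1)"
    have "agree i" if "a - 1 \<le> i" "i \<le> m" for i
      using ag P that unfolding P_def by (cases "i = a - 1") auto
    then have "P (a - 1)"
      by (simp add: P_def)
    then show False
      using not_less_Least[of "a - 1" P] that unfolding a_def by auto
  qed
  moreover have "agree i" if "a \<le> i" "i < c" for i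
    using P c(3) that unfolding P_def by (cases "i \<le> m") auto
  moreover have "m < c"
    using c assms by (metis le_neq_implies_less)
  ultimately have "block a c"
    using c am unfolding block_def by auto
  then show ?thesis
    using that am \<open>m < c\<close> by blast
qed

text \<open>The bound is \<open>c + p\<close> and not \<open>c\<close> since the run extends
  \<open>p\<close> letters past its block.\<close>

lemma block_shift:
  assumes "block a c" "a \<le> i" "i + n * p < c + p"
  shows "x (i + n * p) = x i"
  using assms(3)
proof (induction n)
  case (Suc n)
  then have "agree (i + n * p)"
    using assms(1,2) unfolding block_def by auto
  then show ?case
    using Suc by (simp add: agree_def algebra_simps)
qed simp

text \<open>With \<open>l = (3 + j) * p + l mod p\<close>, the cut is \<open>j * p\<close> or
  \<open>(j + 1) * p\<close>; the lower bound on \<open>l\<close> keeps the subtraction in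
  \<open>cut\<close> from being truncated.\<close>

lemma cut_red:
  assumes "3 * p \<le> l"
  obtains n where "cut f l = n * p" "cut f l + red f l = l" "2 * p \<le> red f l" "red f l < 4 * p"
proof -
  have l: "l = (l div p) * p + l mod p" by simp
  have m: "l mod p < p" using p_pos by simp
  have "3 \<le> l div p"
    using div_le_mono[OF assms, of p] p_pos by simp
  then obtain j where j: "l div p = 3 + j"
    using le_Suc_ex by blast
  have l': "l = 3 * p + j * p + l mod p"
    using l unfolding j by (simp add: algebra_simps)
  have "cut f l = (if l \<in> f then j else Suc j) * p" "cut f l + red f l = l"
    using l' unfolding cut_def red_def by auto
  moreover have "2 * p \<le> red f l" "red f l < 4 * p"
    using m unfolding red_def by auto
  ultimately show ?thesis
    by (rule that)
qed

lemma long_block_cut: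
  assumes "long_block a c"
  obtains n where "cut f (c - a) = n * p" "a + cut f (c - a) + red f (c - a) = c"
    "2 * p \<le> red f (c - a)" "red f (c - a) < 4 * p"
proof -
  have l: "3 * p \<le> c - a" "a < c"
    using assms unfolding long_block_def block_def by auto
  show ?thesis
  proof (rule cut_red[OF l(1)])
    fix n assume "cut f (c - a) = n * p" "cut f (c - a) + red f (c - a) = c - a"
      "2 * p \<le> red f (c - a)" "red f (c - a) < 4 * p"
    then show ?thesis
      using that l(2) by force
  qed
qed

text \<open>The block keeps at least \<open>2 * p\<close> positions, exactly \<open>p\<close> of
  them before the deleted part, hence at least \<open>p\<close> behind it; this gives
  \<open>q + p < c\<close>.\<close>

lemma delE:
  assumes "q \<in> del f"
  obtains a c where "long_block a c" "block a c" "a + p \<le> q" "q < a + p + cut f (c - a)" "q + p < c"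
proof -
  obtain a c where ac: "long_block a c" "a + p \<le> q" "q < a + p + cut f (c - a)"
    using assms unfolding del_def by blast
  obtain n where "a + cut f (c - a) + red f (c - a) = c" "2 * p \<le> red f (c - a)"
    by (rule long_block_cut[OF ac(1), of f]) blast
  then have "q + p < c" using ac by linarith
  then show ?thesis
    using that ac unfolding long_block_def by blast
qed

lemma del_in_block:
  assumes "block a c" "a \<le> q" "q < c"
  shows "q \<in> del f \<longleftrightarrow> long_block a c \<and> a + p \<le> q \<and> q < a + p + cut f (c - a)"
proof
  assume "q \<in> del f"
  then obtain a' c' where ac: "long_block a' c'" "block a' c'" "a' + p \<le> q"
      "q < a' + p + cut f (c' - a')" "q + p < c'"
    by (rule delE)
  then show "long_block a c \<and> a + p \<le> q \<and> q < a + p + cut f (c - a)"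
    using block_unique[OF assms(1) ac(2), of q] assms by auto
qed (auto simp: del_def)

text \<open>Mostly used in contraposed form: a break is never deleted.\<close>

lemma agree_del: "q \<in> del f \<Longrightarrow> agree q"
  by (erule delE) (auto simp: block_def)

section \<open>Positions of \<open>x\<close> and positions of the shortened word\<close>

lemma infinite_kept: "infinite (kept f)"
proof
  assume "finite (kept f)"
  moreover have "{i. x i \<noteq> x (i + p)} \<subseteq> kept f"
    using agree_del unfolding agree_def by auto
  ultimately show False
    using infinite_breaks finite_subset by blast
qed

lemma pos_kept: "pos f n \<in> kept f"
  unfolding pos_def using enumerate_in_set[OF infinite_kept] .

lemma pos_less_iff: "pos f i < pos f j \<longleftrightarrow> i < j"
  unfolding pos_def using strict_mono_enumerate[OF infinite_kept] by (simp add: strict_mono_less)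

lemma pos_surj: "m \<in> kept f \<Longrightarrow> \<exists>n. m = pos f n"
  unfolding pos_def using range_enumerate[OF infinite_kept, of f] by (metis rangeE)

lemma idx_pos [simp]: "idx f (pos f n) = n"
proof -
  have "set (filter (\<lambda>q. q \<in> kept f) [0..<pos f n]) = pos f ` {..<n}"
    using pos_surj[of _ f] pos_less_iff[of f] pos_kept[of f] by fastforce
  moreover have "inj_on (pos f) {..<n}"
    by (intro inj_onI) (metis pos_less_iff less_irrefl linorder_neqE_nat)
  ultimately have "card (set (filter (\<lambda>q. q \<in> kept f) [0..<pos f n])) = n"
    by (simp add: card_image)
  then show ?thesis
    unfolding idx_def by (subst (asm) distinct_card) auto
qed

lemma pos_idx [simp]: "m \<in> kept f \<Longrightarrow> pos f (idx f m) = m"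
  using pos_surj[of m f] by auto

lemma idx_add:
  assumes "s \<le> t"
  shows "idx f t = idx f s + length (filter (\<lambda>q. q \<in> kept f) [s..<t])"
  using upt_add_eq_append[of 0 s "t - s"] assms unfolding idx_def by simp

lemma idx_mono: "s \<le> t \<Longrightarrow> idx f s \<le> idx f t"
  using idx_add by simp

lemma idx_Suc: "idx f (Suc m) = idx f m + (if m \<in> kept f then 1 else 0)"
  by (simp add: idx_def)

lemma idx_less_iff:
  assumes "m \<in> kept f"
  shows "idx f m < idx f t \<longleftrightarrow> m < t"
proof
  assume "m < t"
  then show "idx f m < idx f t"
    using idx_mono[of "Suc m" t f] assms by (simp add: idx_Suc)
qed (use idx_mono[of t m f] in \<open>auto simp: not_less[symmetric]\<close>)

lemma pos_less_idx: "pos f n < t \<longleftrightarrow> n < idx f t"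
  using idx_less_iff[OF pos_kept, of f n t] by simp

lemma short_idx: "m \<in> kept f \<Longrightarrow> short f (idx f m) = x m"
  by (simp add: short_def)

text \<open>Connects deletion inside an interval of \<open>x\<close> with factors of
  \<open>short f\<close>: both sides list the same kept positions in increasing order.\<close>

lemma map_kept: "map x (filter (\<lambda>q. q \<in> kept f) [s..<t]) = subsequence (short f) (idx f s) (idx f t)"
proof -
  have "map (pos f) [idx f s..<idx f t] = filter (\<lambda>q. q \<in> kept f) [s..<t]"
  proof (rule sorted_distinct_set_unique)
    show "sorted (map (pos f) [idx f s..<idx f t])"
      unfolding sorted_map
      by (rule sorted_wrt_mono_rel[OF _ sorted_upt]) (metis pos_less_iff not_less)
    show "distinct (map (pos f) [idx f s..<idx f t])"
      unfolding distinct_map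
      by (auto intro!: inj_onI) (metis idx_pos)
    show "sorted (filter (\<lambda>q. q \<in> kept f) [s..<t])" "distinct (filter (\<lambda>q. q \<in> kept f) [s..<t])"
      by (auto simp: sorted_wrt_filter)
    show "set (map (pos f) [idx f s..<idx f t]) = set (filter (\<lambda>q. q \<in> kept f) [s..<t])"
    proof (intro equalityI subsetI)
      fix m assume "m \<in> set (map (pos f) [idx f s..<idx f t])"
      then obtain n where n: "m = pos f n" "idx f s \<le> n" "n < idx f t" by auto
      then have "\<not> pos f n < s" "pos f n < t"
        by (auto simp: pos_less_idx)
      then show "m \<in> set (filter (\<lambda>q. q \<in> kept f) [s..<t])"
        using n pos_kept[of f n] by auto
    next
      fix m assume "m \<in> set (filter (\<lambda>q. q \<in> kept f) [s..<t])"
      then have m: "m \<in> kept f" "s \<le> m" "m < t" by auto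
      then have "idx f s \<le> idx f m" "idx f m < idx f t"
        using idx_mono idx_less_iff by auto
      then have "pos f (idx f m) \<in> set (map (pos f) [idx f s..<idx f t])"
        by auto
      then show "m \<in> set (map (pos f) [idx f s..<idx f t])"
        using m by simp
    qed
  qed
  then have "map x (filter (\<lambda>q. q \<in> kept f) [s..<t]) = map x (map (pos f) [idx f s..<idx f t])"
    by simp
  then show ?thesis
    by (simp add: subsequence_def short_def)
qed

lemma idx_all_kept:
  assumes "\<And>q. s \<le> q \<Longrightarrow> q < s + n \<Longrightarrow> q \<in> kept f"
  shows "idx f (s + n) = idx f s + n"
  using assms by (induction n) (auto simp: idx_Suc)

text \<open>If a deleted part meets \<open>[m, m + p]\<close>, then \<open>m\<close> is among the
  first \<open>p\<close> positions of its block. The letter \<open>p\<close> places on in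
  \<open>short f\<close> then comes from \<open>m + p + n * p\<close>, still in the block, and
  periodicity gives the same letter as at \<open>m + p\<close>.\<close>

lemma short_add_period:
  assumes m: "m \<in> kept f"
  shows "short f (idx f m + p) = x (m + p)"
proof (cases "\<exists>q\<in>del f. m \<le> q \<and> q \<le> m + p")
  case False
  then have del: "q \<in> kept f" if "m \<le> q" "q \<le> m + p" for q
    using that by blast
  have "idx f (m + p) = idx f m + p"
    by (rule idx_all_kept, rule del) auto
  moreover have "m + p \<in> kept f"
    by (rule del) auto
  ultimately show ?thesis
    using short_idx[of "m + p" f] by simp
next
  case True
  then obtain q where q: "q \<in> del f" "m \<le> q" "q \<le> m + p" by blast
  obtain a c where ac: "long_block a c" "block a c" "a + p \<le> q" "q < a + p + cut f (c - a)" "q + p < c"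
    using q(1) by (rule delE)
  obtain n where n: "cut f (c - a) = n * p" "a + cut f (c - a) + red f (c - a) = c"
      "2 * p \<le> red f (c - a)"
    by (rule long_block_cut[OF ac(1), of f]) blast
  have am: "a \<le> m" "m < a + p"
    using m ac q del_in_block[OF ac(2), of m f] by auto
  let ?t = "m + p + n * p"
  have tc: "?t < c" using am n by linarith
  have del: "r \<in> kept f \<longleftrightarrow> \<not> (a + p \<le> r \<and> r < a + p + n * p)" if "m \<le> r" "r \<le> ?t" for r
    using del_in_block[OF ac(2), of r f] that am tc ac(1) n(1) by auto
  have "filter (\<lambda>r. r \<in> kept f) [m..<?t] = [m..<min ?t (a + p)] @ [max m (a + p + n * p)..<?t]"
    by (rule filter_upt_gap) (use del in auto)
  then have "length (filter (\<lambda>r. r \<in> kept f) [m..<?t]) = p"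
    using am by simp
  then have "idx f ?t = idx f m + p"
    using idx_add[of m ?t f] by simp
  moreover have "?t \<in> kept f"
    using del[of ?t] am by simp
  ultimately have "short f (idx f m + p) = x ?t"
    using short_idx by metis
  also have "\<dots> = x (m + p)"
    by (rule block_shift[OF ac(2)]) (use am tc in auto)
  finally show ?thesis .
qed

text \<open>Shortening neither creates nor destroys breaks, so the breaks of \<open>x\<close> can be
  read off from \<open>short f\<close>.\<close>

lemma short_agree_iff:
  "short f n = short f (n + p) \<longleftrightarrow> agree (pos f n)"
  using short_add_period[OF pos_kept, of f n] by (simp add: short_def agree_def)

text \<open>Gives the distance of consecutive breaks after shortening. The case \<open>a = c\<close>
  covers adjacent breaks with no block between them.\<close>

lemma idx_break:
  assumes "a = 0 \<or> \<not> agree (a - 1)" "a \<le> c" "\<forall>i\<in>{a..<c}. agree i" "\<not> agree c"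
  shows "idx f c = idx f a + (if long_block a c then red f (c - a) else c - a)"
proof (cases "long_block a c")
  case True
  obtain n where n: "cut f (c - a) = n * p" "a + cut f (c - a) + red f (c - a) = c"
      "2 * p \<le> red f (c - a)"
    by (rule long_block_cut[OF True, of f]) blast
  have "filter (\<lambda>r. r \<in> kept f) [a..<c]
      = [a..<min c (a + p)] @ [max a (a + p + cut f (c - a))..<c]"
    by (rule filter_upt_gap) (use True del_in_block[of a c] in \<open>auto simp: long_block_def\<close>)
  moreover have "a + p \<le> c" using n by linarith
  ultimately have "length (filter (\<lambda>r. r \<in> kept f) [a..<c]) = red f (c - a)"
    using n by simp
  then show ?thesis
    using idx_add[OF assms(2), of f] True by simp
next
  case False
  have "q \<in> kept f" if "a \<le> q" "q < c" for q
    using del_in_block[of a c q f] that assms False unfolding block_def by auto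
  then show ?thesis
    using idx_all_kept[of a "c - a" f] False assms(2) by auto
qed

text \<open>Breaks are visible in the shortened words, so equal suffixes reach their first break
  after equally many letters. If one break came earlier, the other side would have a break inside
  its agreeing stretch; the situation is symmetric.\<close>

lemma first_break_eq:
  assumes "a \<le> c" "\<forall>i\<in>{a..<c}. agree i" "\<not> agree c"
    and "a' \<le> c'" "\<forall>i\<in>{a'..<c'}. agree i" "\<not> agree c'"
    and eq: "\<And>i. short f (idx f a + i) = short g (idx g a' + i)"
  shows "idx f c - idx f a = idx g c' - idx g a'"
proof -
  have le: "idx g c' - idx g a' \<le> idx f c - idx f a"
    if "a \<le> c" "\<not> agree c"
      and "a' \<le> c'" "\<forall>i\<in>{a'..<c'}. agree i"
      and eq: "\<And>i. short f (idx f a + i) = short g (idx g a' + i)" for a c a' c' f g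
  proof (rule ccontr)
    assume less: "\<not> ?thesis"
    define i where "i = idx f c - idx f a"
    have c: "idx f c = idx f a + i"
      using idx_mono[OF that(1)] by (simp add: i_def)
    have "c \<in> kept f"
      using agree_del that(2) by auto
    then have "short f (idx f a + i) \<noteq> short f (idx f a + i + p)"
      using that(2) unfolding short_agree_iff by (simp flip: c)
    then have "short g (idx g a' + i) \<noteq> short g (idx g a' + i + p)"
      using eq[of i] eq[of "i + p"] by (simp add: add.assoc)
    then have "\<not> agree (pos g (idx g a' + i))"
      by (simp add: short_agree_iff)
    moreover have "pos g (idx g a' + i) < c'"
      using less unfolding pos_less_idx i_def by simp
    moreover have "\<not> pos g (idx g a' + i) < a'"
      unfolding pos_less_idx by simp
    ultimately show False
      using that(4) by auto
  qed
  show ?thesis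
    using le[of a c a' c' f g] le[of a' c' a c g f] assms by (simp add: le_antisym)
qed

section \<open>Powers are removed and aperiodicity is preserved\<close>

text \<open>A fifth power gives \<open>4 * p\<close> consecutive agreeing positions, so it stems
  from one block that keeps at least \<open>4 * p\<close> positions. A long block keeps fewer. Any
  other block is untouched, so it contains \<open>v\<close> in \<open>x\<close> itself and would be
  long.\<close>

lemma fifth_power_not_in_short:
  assumes v: "v \<in> {u, rev u}"
  shows "word_power v 5 \<notin> factors (short f)"
proof
  assume "word_power v 5 \<in> factors (short f)"
  then obtain i j where ij: "subsequence (short f) i j = word_power v 5"
    unfolding factors_def by auto
  have lv: "length v = p" using v by auto
  have nth: "short f (i + r) = v ! (r mod p)" if "r < 5 * p" for r
    using factor_nth[OF ij, of r] that lv by (simp add: length_word_power nth_word_power)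
  have ag: "agree (pos f (i + r))" if "r < 4 * p" for r
    using nth[of r] nth[of "r + p"] that by (simp flip: short_agree_iff add: add.assoc)
  define m where "m = pos f i"
  have "agree m" using ag[of 0] p_pos by (simp add: m_def)
  then obtain a c where ac: "block a c" "a \<le> m" "m < c"
    by (rule block_exists)
  have "c \<in> kept f"
    using ac(1) agree_del unfolding block_def by auto
  have "i + 4 * p \<le> idx f c"
  proof (rule ccontr)
    assume "\<not> ?thesis"
    then have less: "idx f c < i + 4 * p" by simp
    have "i < idx f c"
      using ac(3) by (simp add: m_def pos_less_idx)
    then have "agree (pos f (i + (idx f c - i)))"
      using less by (intro ag) auto
    then show False
      using ac(1) \<open>c \<in> kept f\<close> \<open>i < idx f c\<close> unfolding block_def by simp
  qed
  moreover have "idx f a \<le> i"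
    using idx_mono[OF ac(2), of f] by (simp add: m_def)
  moreover have c: "idx f c = idx f a + (if long_block a c then red f (c - a) else c - a)"
    using ac by (intro idx_break) (auto simp: block_def)
  ultimately have big: "4 * p \<le> (if long_block a c then red f (c - a) else c - a)"
    by linarith
  show False
  proof (cases "long_block a c")
    case True
    obtain n where "red f (c - a) < 4 * p"
      by (rule long_block_cut[OF True, of f]) blast
    then show False using big True by simp
  next
    case False
    have kept: "q \<in> kept f" if "a \<le> q" "q < c" for q
      using del_in_block[OF ac(1) that, of f] False by auto
    have idxm: "idx f (m + r) = i + r" if "m + r \<le> c" for r
      using idx_all_kept[of m r f] kept that ac(2) by (auto simp: m_def)
    have "idx f c = i + (c - m)"
      using idxm[of "c - m"] ac(3) by simp
    then have mc: "m + 4 * p \<le> c"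
      using \<open>i + 4 * p \<le> idx f c\<close> ac(3) by linarith
    have "subsequence x m (m + p) = v"
    proof (rule nth_equalityI)
      fix r assume "r < length (subsequence x m (m + p))"
      then have r: "r < p" by simp
      then have "m + r < c" using mc by linarith
      then have "x (m + r) = short f (i + r)"
        using short_idx[OF kept, of "m + r"] idxm[of r] ac(2) by simp
      then show "subsequence x m (m + p) ! r = v ! r"
        using nth[of r] r by simp
    qed (simp add: lv)
    moreover have "3 * p \<le> c - a"
      using big False by simp
    ultimately have "long_block a c"
      using ac v unfolding long_block_def by (metis atLeastAtMost_iff less_imp_le)
    then show False using False by simp
  qed
qed

section \<open>Recovering \<open>x\<close> from its shortened words\<close>

text \<open>A long block is recognizable inside a window of \<open>x\<close>: the breaks at
  \<open>z\<close> and \<open>z'\<close> force it to start inside the window, and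
  \<open>c < n\<close> keeps its closing break and the whole run inside.\<close>

lemma long_block_transfer:
  assumes x: "\<And>r. r < n + p \<Longrightarrow> x (z + r) = x (z' + r)"
    and z: "\<not> agree z" "\<not> agree z'"
    and b: "long_block (z + a) (z + c)" "c < n"
  shows "long_block (z' + a) (z' + c)"
proof -
  have ag: "agree (z + r) \<longleftrightarrow> agree (z' + r)" if "r < n" for r
    using x[of r] x[of "r + p"] that by (simp add: agree_def add.assoc)
  have bl: "a < c" "\<And>r. a \<le> r \<Longrightarrow> r < c \<Longrightarrow> agree (z + r)" "\<not> agree (z + c)"
    "z + a = 0 \<or> \<not> agree (z + a - 1)"
    using b(1) unfolding long_block_def block_def by auto
  have "agree (z + a)" using bl(1,2) by simp
  then have "a \<noteq> 0" using z by (cases a) auto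
  then obtain a' where a': "a = Suc a'" by (cases a) auto
  have "agree i" if "i \<in> {z' + a..<z' + c}" for i
    using bl(2)[of "i - z'"] ag[of "i - z'"] that b(2) by auto
  then have "block (z' + a) (z' + c)"
    using bl ag[of c] ag[of a'] b(2) unfolding block_def a' by auto
  moreover obtain m where m: "z + a \<le> m" "m \<le> z + c" "subsequence x m (m + p) \<in> {u, rev u}"
    using b(1) unfolding long_block_def by auto
  have "subsequence x (z' + (m - z)) (z' + (m - z) + p) = subsequence x m (m + p)"
  proof (rule nth_equalityI)
    fix r assume "r < length (subsequence x (z' + (m - z)) (z' + (m - z) + p))"
    then show "subsequence x (z' + (m - z)) (z' + (m - z) + p) ! r = subsequence x m (m + p) ! r"
      using x[of "m - z + r"] m b(2) by (simp add: add.assoc)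
  qed simp
  then have "\<exists>m\<in>{z' + a..z' + c}. subsequence x m (m + p) \<in> {u, rev u}"
    using m by (intro bexI[of _ "z' + (m - z)"]) auto
  moreover have "3 * p \<le> (z' + c) - (z' + a)"
    using b(1) unfolding long_block_def by simp
  ultimately show ?thesis
    unfolding long_block_def by blast
qed

text \<open>The breaks at offsets \<open>0\<close> and \<open>s\<close> enclose the block of the
  deleted position, so that block transfers as a whole.\<close>

lemma del_transfer:
  assumes x: "\<And>r. r < n + p \<Longrightarrow> x (z + r) = x (z' + r)"
    and z: "\<not> agree z" "\<not> agree z'"
    and s: "\<not> agree (z + s)" "s < n" "r \<le> s" "z + r \<in> del f"
  shows "z' + r \<in> del f"
proof -
  obtain a c where ac: "long_block a c" "block a c" "a + p \<le> z + r"
      "z + r < a + p + cut f (c - a)" "z + r + p < c"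
    using s(4) by (rule delE)
  have "\<not> a \<le> z"
    using ac z(1) unfolding block_def by auto
  moreover have "\<not> z + s < c"
    using ac s(1,3) unfolding block_def by auto
  moreover define \<alpha> \<gamma> where "\<alpha> = a - z" and "\<gamma> = c - z"
  ultimately have eq: "a = z + \<alpha>" "c = z + \<gamma>" "\<gamma> \<le> s"
    using ac(5) by auto
  have "long_block (z' + \<alpha>) (z' + \<gamma>)"
    using long_block_transfer[of n z z' \<alpha> \<gamma>] x z ac(1) eq s(2) by simp
  then show ?thesis
    using ac(3,4) unfolding eq del_def
    by (intro CollectI exI[of _ "z' + \<alpha>"] exI[of _ "z' + \<gamma>"]) auto
qed

text \<open>Elements of \<open>f\<close> outside this set do not influence \<open>short f\<close>,
  so the parameters are taken from its power set.\<close>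

definition block_lengths :: "nat set" where
  "block_lengths = {c - a | a c. long_block a c}"

text \<open>Putting the length \<open>l\<close> of a long block into \<open>f\<close> raises its
  shortened length by \<open>p\<close>, to at least \<open>3 * p\<close>. A stretch that is not long
  does not react, and a long block of another length stays below \<open>3 * p\<close> for
  \<open>f = {l}\<close>. So \<open>{}\<close> and the singletons tell distances apart.\<close>

lemma break_distance_eq:
  assumes "\<And>f. f \<subseteq> block_lengths \<Longrightarrow>
      (if long_block a c then red f (c - a) else c - a) =
      (if long_block a' c' then red f (c' - a') else c' - a')"
  shows "c - a = c' - a'"
proof -
  have in1: "c - a \<in> block_lengths" if "long_block a c" for a c
    using that unfolding block_lengths_def by blast
  have m: "l mod p < p" for l using p_pos by simp
  show ?thesis
  proof (rule ccontr)
    assume ne: "c - a \<noteq> c' - a'"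
    show False
    proof (cases "long_block a c")
      case True
      have "red {} (c - a) < red {c - a} (c - a)"
        using p_pos by (simp add: red_def)
      moreover have "red {c - a} (c' - a') < red {c - a} (c - a)"
        using ne m[of "c' - a'"] by (auto simp: red_def)
      ultimately show False
        using assms[of "{}"] assms[of "{c - a}"] True in1[OF True] by (auto split: if_splits)
    next
      case False
      note not1 = this
      show False
      proof (cases "long_block a' c'")
        case True
        have "red {} (c' - a') < red {c' - a'} (c' - a')"
          using p_pos by (simp add: red_def)
        then show False
          using assms[of "{}"] assms[of "{c' - a'}"] not1 True in1[OF True] by auto
      qed (use assms[of "{}"] ne not1 in auto)
    qed
  qed
qed

text \<open>Strong induction on the offset. Once the letters before \<open>q\<close> are known to
  agree, so are the breaks and deletions up to the last break before \<open>q - p\<close>; the next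
  break then decides the letter at \<open>q\<close>.\<close>

lemma suffix_eq_if_short_eq:
  assumes z: "\<not> agree z" "\<not> agree z'"
    and eq: "\<And>f i. f \<subseteq> block_lengths \<Longrightarrow> short f (idx f z + i) = short f (idx f z' + i)"
  shows "x (z + q) = x (z' + q)"
proof (induction q rule: less_induct)
  case (less q)
  \<comment> \<open>A block reaching that far starts after the break \<open>z\<close>, and its first
    \<open>p\<close> positions are never deleted.\<close>
  have kept_start: "z + r \<in> kept f" if "\<not> agree z" "r \<le> p" for z r f
  proof
    assume "z + r \<in> del f"
    then obtain a c where "block a c" "a + p \<le> z + r" "z + r + p < c"
      by (rule delE)
    then show False
      using that unfolding block_def by auto
  qed
  show ?case
  proof (cases "q \<le> p")
    case True
    have "idx {} (z + q) = idx {} z + q" if "\<not> agree z" for z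
    proof (rule idx_all_kept)
      fix i assume "z \<le> i" "i < z + q"
      then show "i \<in> kept {}"
        using kept_start[of z "i - z" "{}"] that True by simp
    qed
    moreover have "z + q \<in> kept {}" "z' + q \<in> kept {}"
      using kept_start z True by auto
    ultimately show ?thesis
      using eq[of "{}" q] z short_idx[of "z + q" "{}"] short_idx[of "z' + q" "{}"] by simp
  next
    case False
    define n where "n = q - p"
    have q: "q = n + p" "0 < n" using False by (auto simp: n_def)
    have x: "x (z + r) = x (z' + r)" if "r < n + p" for r
      using less that q by simp
    have ag: "agree (z + r) \<longleftrightarrow> agree (z' + r)" if "r < n" for r
      using x[of r] x[of "r + p"] that by (simp add: agree_def add.assoc)
    \<comment> \<open>The last break before offset \<open>n\<close>. Deletions up to it coincide on
      both sides, so the comparison can restart just behind it, at \<open>a = Suc s\<close>.\<close>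
    define s where "s = (GREATEST s. s < n \<and> \<not> agree (z + s))"
    have "s < n \<and> \<not> agree (z + s)"
      unfolding s_def by (rule GreatestI_nat[of _ 0 n]) (use q z in auto)
    then have s: "s < n" "\<not> agree (z + s)" "\<not> agree (z' + s)"
      using ag by auto
    have max: "agree (z + r)" if "s < r" "r < n" for r
      using Greatest_le_nat[of "\<lambda>s. s < n \<and> \<not> agree (z + s)" r n] that unfolding s_def by auto
    have del: "z + r \<in> del f \<longleftrightarrow> z' + r \<in> del f" if "r \<le> s" for r f
      using del_transfer[OF x z s(2,1) that] del_transfer[OF x[symmetric] z(2,1) s(3,1) that]
      by blast
    have idx: "idx f (z + r) + idx f z' = idx f (z' + r) + idx f z" if "r \<le> Suc s" for r f
      using that
    proof (induction r)
      case (Suc r)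
      then show ?case using del[of r f] by (simp add: idx_Suc)
    qed simp
    define a where "a = Suc s"
    have eq_a: "short f (idx f (z + a) + i) = short f (idx f (z' + a) + i)"
      if "f \<subseteq> block_lengths" for f i
    proof -
      have "idx f z \<le> idx f (z + a)" by (rule idx_mono) simp
      then obtain d where "idx f (z + a) = idx f z + d" using le_Suc_ex by blast
      moreover from this have "idx f (z' + a) = idx f z' + d"
        using idx[of a f] by (simp add: a_def)
      ultimately show ?thesis
        using eq[OF that, of "d + i"] by (simp add: add.assoc)
    qed
    have "\<exists>c\<ge>n. \<not> agree (y + c) \<and> (\<forall>r. n \<le> r \<longrightarrow> r < c \<longrightarrow> agree (y + r))" for y
    proof -
      obtain w where w: "y + n \<le> w" "\<not> agree w" "\<forall>i\<in>{y + n..<w}. agree i"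
        using next_break by blast
      then obtain c where "w = y + c" "n \<le> c"
        using le_Suc_ex[of "y + n" w] by auto
      then show ?thesis using w by auto
    qed
    then obtain c c' where
      c: "n \<le> c" "\<not> agree (z + c)" "\<And>r. n \<le> r \<Longrightarrow> r < c \<Longrightarrow> agree (z + r)" and
      c': "n \<le> c'" "\<not> agree (z' + c')" "\<And>r. n \<le> r \<Longrightarrow> r < c' \<Longrightarrow> agree (z' + r)"
      by metis
    have an: "a \<le> n" using s by (simp add: a_def)
    have "agree (z + r)" if "a \<le> r" "r < c" for r
      using that max[of r] c(3)[of r] by (cases "r < n") (auto simp: a_def)
    then have st: "\<forall>i\<in>{z + a..<z + c}. agree i"
      by (auto dest!: le_Suc_ex simp: add.assoc)
    have "agree (z' + r)" if "a \<le> r" "r < c'" for r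
      using that max[of r] c'(3)[of r] ag[of r] by (cases "r < n") (auto simp: a_def)
    then have st': "\<forall>i\<in>{z' + a..<z' + c'}. agree i"
      by (auto dest!: le_Suc_ex simp: add.assoc)
    have idx_c: "idx f (z + c) = idx f (z + a) +
        (if long_block (z + a) (z + c) then red f (z + c - (z + a)) else z + c - (z + a))" for f
      by (rule idx_break) (use s c an st in \<open>auto simp: a_def\<close>)
    have idx_c': "idx f (z' + c') = idx f (z' + a) +
        (if long_block (z' + a) (z' + c') then red f (z' + c' - (z' + a)) else z' + c' - (z' + a))" for f
      by (rule idx_break) (use s c' an st' in \<open>auto simp: a_def\<close>)
    have dist: "idx f (z + c) - idx f (z + a) = idx f (z' + c') - idx f (z' + a)"
      if "f \<subseteq> block_lengths" for f
      by (rule first_break_eq) (use eq_a[OF that] c c' an st st' in auto)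
    \<comment> \<open>Only here all sets \<open>f\<close> are needed at once: a single shortened
      distance does not determine the original one.\<close>
    have "z + c - (z + a) = z' + c' - (z' + a)"
      by (rule break_distance_eq) (use dist idx_c idx_c' in simp)
    then have cc: "c' = c" using an c(1) c'(1) by simp
    show ?thesis
    proof (cases "c = n")
      case False
      then have "agree (z + n)" "agree (z' + n)"
        using c c' cc by auto
      then show ?thesis
        using x[of n] p_pos unfolding agree_def q by (simp add: add.assoc)
    next
      case True
      then have kept: "z + n \<in> kept {}" "z' + n \<in> kept {}"
        using c(2) c'(2) cc agree_del by auto
      \<comment> \<open>With a break at \<open>n\<close>, periodicity says nothing about the letter
        at \<open>q = n + p\<close>. It is read off from \<open>short {}\<close>, \<open>p\<close>
        places after the image of the break.\<close>
      define i where "i = idx {} (z + n) - idx {} (z + a)"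
      have "idx {} (z + n) = idx {} (z + a) + i"
        using idx_mono[of "z + a" "z + n" "{}"] an by (simp add: i_def)
      moreover have "idx {} (z' + n) = idx {} (z' + a) + i"
        using idx_mono[of "z' + a" "z' + n" "{}"] an dist[of "{}"] cc True by (simp add: i_def)
      ultimately have "short {} (idx {} (z + n) + p) = short {} (idx {} (z' + n) + p)"
        using eq_a[of "{}" "i + p"] by (simp add: add.assoc)
      then show ?thesis
        using short_add_period[OF kept(1)] short_add_period[OF kept(2)] q by (simp add: add.assoc)
    qed
  qed
qed

text \<open>At the first long block whose length distinguishes \<open>f\<close> from
  \<open>g\<close>, everything before is deleted alike, but the distance to the next break differs
  by \<open>p\<close>.\<close>

lemma short_inj: "inj_on short (Pow block_lengths)"
proof (rule inj_onI, rule ccontr)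
  fix f g
  assume f: "f \<in> Pow block_lengths" and g: "g \<in> Pow block_lengths"
    and eq: "short f = short g" and ne: "f \<noteq> g"
  define P where "P = (\<lambda>a. \<exists>c. long_block a c \<and> (c - a \<in> f) \<noteq> (c - a \<in> g))"
  have "\<exists>l\<in>block_lengths. (l \<in> f) \<noteq> (l \<in> g)"
    using f g ne by blast
  then have "\<exists>a. P a"
    unfolding P_def block_lengths_def by auto
  define a where "a = (LEAST a. P a)"
  have "P a" unfolding a_def using \<open>\<exists>a. P a\<close> by (rule LeastI_ex)
  then obtain c where c: "long_block a c" "(c - a \<in> f) \<noteq> (c - a \<in> g)"
    unfolding P_def by blast
  have bl: "block a c" using c unfolding long_block_def by simp
  have del: "q \<in> del f \<longleftrightarrow> q \<in> del g" if "q < a" for q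
  proof -
    have cut: "cut f (c' - a') = cut g (c' - a')" if "long_block a' c'" "a' < a" for a' c'
    proof -
      have "\<not> P a'"
        using not_less_Least[of a' P] that(2) by (simp add: a_def)
      then have "c' - a' \<in> f \<longleftrightarrow> c' - a' \<in> g"
        using that(1) unfolding P_def by blast
      then show ?thesis by (simp add: cut_def red_def)
    qed
    have "long_block a' c' \<and> a' + p \<le> q \<and> q < a' + p + cut f (c' - a') \<longleftrightarrow>
        long_block a' c' \<and> a' + p \<le> q \<and> q < a' + p + cut g (c' - a')" for a' c'
      using cut[of a' c'] that by auto
    then show ?thesis
      unfolding del_def by simp
  qed
  then have "filter (\<lambda>q. q \<in> kept f) [0..<a] = filter (\<lambda>q. q \<in> kept g) [0..<a]"
    by (intro filter_cong) auto
  then have idx_a: "idx f a = idx g a"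
    by (simp add: idx_def)
  have "idx f c - idx f a = idx g c - idx g a"
    by (rule first_break_eq) (use bl eq idx_a in \<open>auto simp: block_def\<close>)
  moreover have "idx h c = idx h a + red h (c - a)" for h
    using idx_break[of a c h] bl c(1) by (auto simp: block_def)
  ultimately have "red f (c - a) = red g (c - a)" by simp
  then show False
    using c(2) p_pos by (auto simp: red_def)
qed

lemma short_not_ultimately_periodic:
  assumes "finite (range x)" "\<not> ultimately_periodic x"
  shows "\<exists>f. \<not> ultimately_periodic (short f)"
proof (rule ccontr)
  assume "\<not> ?thesis"
  then have up: "ultimately_periodic (short f)" for f by blast
  have "short ` Pow block_lengths \<subseteq> {y. range y \<subseteq> range x \<and> ultimately_periodic y}"
    using up by (auto simp: short_def)
  then have "countable (short ` Pow block_lengths)"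
    using countable_ultimately_periodic[OF assms(1)] countable_subset by blast
  then have "countable (Pow block_lengths)"
    using short_inj countable_image_inj_on by blast
  then have fin: "finite block_lengths"
    using uncountable_Pow by blast
  \<comment> \<open>Each break is sent to the tuple of suffixes that start at it in all shortened
    words. This is a finite product of finite sets, while there are infinitely many breaks.\<close>
  define F where "F = (\<lambda>z. \<lambda>f\<in>Pow block_lengths. suffix (idx f z) (short f))"
  have "F ` {z. \<not> agree z} \<subseteq> (\<Pi>\<^sub>E f\<in>Pow block_lengths. range (\<lambda>i. suffix i (short f)))"
    unfolding F_def by (simp add: image_subset_iff restrict_PiE_iff)
  moreover have "finite (\<Pi>\<^sub>E f\<in>Pow block_lengths. range (\<lambda>i. suffix i (short f)))"
    using fin finite_suffixes[OF up] by (intro finite_PiE) auto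
  ultimately have "finite (F ` {z. \<not> agree z})"
    by (rule finite_subset)
  moreover have inf: "infinite {z. \<not> agree z}"
    using infinite_breaks unfolding agree_def .
  ultimately have "\<not> inj_on F {z. \<not> agree z}"
    using finite_imageD by blast
  then obtain z z' where "\<not> agree z" "\<not> agree z'" "F z = F z'" "z \<noteq> z'"
    unfolding inj_on_def by auto
  then obtain z z' where z: "\<not> agree z" "\<not> agree z'" "F z = F z'" "z < z'"
    by (metis linorder_neqE_nat)
  have "short f (idx f z + i) = short f (idx f z' + i)" if "f \<subseteq> block_lengths" for f i
  proof -
    have "suffix (idx f z) (short f) = suffix (idx f z') (short f)"
      using fun_cong[OF z(3), of f] that by (simp add: F_def)
    then show ?thesis
      by (metis suffix_nth)
  qed
  then have eq: "x (z + q) = x (z' + q)" for q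
    by (rule suffix_eq_if_short_eq[OF z(1,2)])
  have "ultimately_periodic x"
  proof (rule ultimately_periodicI[of "z' - z" z])
    fix i assume i: "z \<le> i"
    then have "z' + (i - z) = i + (z' - z)"
      using z(4) by simp
    with i show "x i = x (i + (z' - z))"
      using eq[of "i - z"] by simp
  qed (use z in simp)
  then show False using assms(2) by simp
qed

section \<open>Factors avoiding \<open>u\<close> and its reversal survive\<close>

text \<open>Every stretch of \<open>2 * p - 1\<close> letters in the run of a long block contains
  \<open>u\<close> or \<open>rev u\<close>. So a factor avoiding both overlaps such a run in fewer
  letters, and periodicity allows to read it across the gap.\<close>

lemma factor_preserved:
  assumes t: "t \<in> Psi x u"
  shows "t \<in> factors (short f)"
proof -
  obtain i j where ij: "t = subsequence x i j"
    using t unfolding Psi_def factors_def by blast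
  have kept: "subsequence x i j \<in> factors (short f)"
    if "\<And>q. i \<le> q \<Longrightarrow> q < j \<Longrightarrow> q \<in> kept f" for i j
  proof -
    have "filter (\<lambda>q. q \<in> kept f) [i..<j] = [i..<j]"
      using that by (simp add: filter_id_conv)
    then show ?thesis
      using map_kept[of f i j] unfolding factors_def subsequence_def by auto
  qed
  have no_u: "\<not> (i \<le> m \<and> m + p \<le> j \<and> subsequence x m (m + p) \<in> {u, rev u})" for m
  proof
    assume m: "i \<le> m \<and> m + p \<le> j \<and> subsequence x m (m + p) \<in> {u, rev u}"
    have "t = subsequence x i m @ subsequence x m (m + p) @ subsequence x (m + p) j"
      using m unfolding ij by (simp add: subsequence_split[of i m j] subsequence_split[of m "m + p" j])
    then have "sublist (subsequence x m (m + p)) t"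
      unfolding sublist_def by blast
    then show False
      using t m unfolding Psi_def fin_factors_def by auto
  qed
  show ?thesis
  proof (cases "\<exists>q\<in>del f. i \<le> q \<and> q < j")
    case False
    then show ?thesis
      unfolding ij by (intro kept) auto
  next
    case True
    define q where "q = (LEAST q. q \<in> del f \<and> i \<le> q \<and> q < j)"
    have q: "q \<in> del f" "i \<le> q" "q < j"
      using LeastI_ex[of "\<lambda>q. q \<in> del f \<and> i \<le> q \<and> q < j"] True unfolding q_def by blast+
    have before_q: "r \<in> kept f" if "i \<le> r" "r < q" for r
      using not_less_Least[of r "\<lambda>q. q \<in> del f \<and> i \<le> q \<and> q < j"] that q(3)
      unfolding q_def by auto
    obtain a c where ac: "long_block a c" "block a c" "a + p \<le> q" "q < a + p + cut f (c - a)"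
      "q + p < c"
      using q(1) by (rule delE)
    define d where "d = cut f (c - a)"
    obtain n where n: "d = n * p" "a + d + red f (c - a) = c" "2 * p \<le> red f (c - a)"
      unfolding d_def by (rule long_block_cut[OF ac(1), of f]) blast
    obtain m where m: "a \<le> m" "m \<le> c" "subsequence x m (m + p) \<in> {u, rev u}"
      using ac(1) unfolding long_block_def by auto
    define m0 where "m0 = a + (m - a) mod p"
    have m_eq: "m = m0 + (m - a) div p * p"
      using m(1) unfolding m0_def by simp
    have window: False if "i \<le> w" "w + 2 * p \<le> Suc j" "a \<le> w" "w + 2 * p \<le> Suc (c + p)" for w
    proof -
      \<comment> \<open>Division rounded up: \<open>m1\<close> is the first position from
        \<open>w\<close> on that is congruent to \<open>m\<close> modulo \<open>p\<close>, where the
        word at \<open>m\<close> recurs.\<close>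
      define s where "s = (w - a + p - 1 - (m - a) mod p) div p"
      define m1 where "m1 = m0 + s * p"
      have lt: "(m - a) mod p < p" using p_pos by simp
      have "(w - a + p - 1 - (m - a) mod p) mod p < p" using p_pos by simp
      moreover have "s * p + (w - a + p - 1 - (m - a) mod p) mod p = w - a + p - 1 - (m - a) mod p"
        unfolding s_def by simp
      ultimately have m1: "w \<le> m1" "m1 < w + p"
        unfolding m1_def m0_def using lt that(3) by linarith+
      have "subsequence x m1 (m1 + p) = subsequence x m (m + p)"
      proof (rule nth_equalityI)
        fix r assume "r < length (subsequence x m1 (m1 + p))"
        then have r: "r < p" by simp
        have "x (m1 + r) = x (m0 + r)"
          using block_shift[OF ac(2), of "m0 + r" s] m1 that r
          unfolding m1_def by (simp add: m0_def algebra_simps)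
        also have "\<dots> = x (m + r)"
          using block_shift[OF ac(2), of "m0 + r" "(m - a) div p"] m_eq m(2) r
          by (simp add: m0_def algebra_simps)
        finally show "subsequence x m1 (m1 + p) ! r = subsequence x m (m + p) ! r"
          using r by simp
      qed simp
      then show False
        using no_u[of m1] m1 that m(3) by auto
    qed
    have "\<not> c + p \<le> j"
      using window[of q] q ac n unfolding d_def[symmetric] by auto
    then have jc: "j < c + p" by simp
    have size: "j + 2 \<le> max i a + 2 * p"
      using window[of "max i a"] jc by fastforce
    \<comment> \<open>A factor starting too far right is moved back by a multiple of
      \<open>p\<close>, so that its start lies before the gap.\<close>
    define i' where "i' = (if i < a + p then i else a + (i - a) mod p)"
    define j' where "j' = i' + (j - i)"
    have i': "i' < a + p"
      using p_pos by (simp add: i'_def)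
    have j'c: "j' + d \<le> c + p" "j' \<le> c + p"
      using size i' n jc q unfolding j'_def i'_def by (auto split: if_splits)
    have t_eq: "subsequence x i' j' = t"
    proof (cases "i < a + p")
      case True
      then show ?thesis using q unfolding ij j'_def i'_def by simp
    next
      case False
      have i: "i = i' + (i - a) div p * p"
        using False unfolding i'_def by simp
      have "x (i' + r) = x (i + r)" if "r < j - i" for r
        using block_shift[OF ac(2), of "i' + r" "(i - a) div p"] i that jc False
        by (simp add: i'_def algebra_simps)
      then show ?thesis
        unfolding ij by (intro nth_equalityI) (auto simp: j'_def)
    qed
    have ii': "i' < a \<Longrightarrow> i' = i"
      by (simp add: i'_def split: if_splits)
    have del: "r \<in> kept f \<longleftrightarrow> \<not> (a + p \<le> r \<and> r < a + p + d)" if "i' \<le> r" "r < c + p" for r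
    proof -
      consider "r < a" | "a \<le> r" "r < c" | "c \<le> r" by linarith
      then show ?thesis
      proof cases
        case 1
        then show ?thesis
          using ii' that before_q[of r] ac(3) by auto
      next
        case 2
        then show ?thesis
          using del_in_block[OF ac(2), of r f] ac(1) unfolding d_def by auto
      next
        case 3
        \<comment> \<open>Behind \<open>c\<close> another block may begin, but it deletes only from
          its start plus \<open>p\<close>, which is beyond \<open>c + p\<close>.\<close>
        have "r \<in> kept f"
        proof
          assume "r \<in> del f"
          then obtain a' c' where ac': "block a' c'" "a' + p \<le> r" "r + p < c'"
            by (rule delE)
          have "a \<noteq> a'"
            using block_unique(2)[OF ac(2) ac'(1), of a] ac(2) ac'(1,3) 3 by (auto simp: block_def)
          moreover have "\<not> a' < a"
            using block_before[OF ac'(1) ac(2)] ac'(3) ac(2) 3 by (auto simp: block_def)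
          ultimately have "a < a'" by simp
          then show False
            using block_before[OF ac(2) ac'(1)] ac' that by linarith
        qed
        then show ?thesis using 3 n p_pos by auto
      qed
    qed
    show ?thesis
    proof (cases "j' \<le> a + p")
      case True
      then have "q \<in> kept f" if "i' \<le> q" "q < j'" for q
        using del[of q] that j'c by auto
      then show ?thesis
        using kept[of i' j'] t_eq by simp
    next
      case False
      have "filter (\<lambda>q. q \<in> kept f) [i'..<j' + d]
          = [i'..<min (j' + d) (a + p)] @ [max i' (a + p + d)..<j' + d]"
        by (rule filter_upt_gap) (use del j'c in auto)
      also have "\<dots> = [i'..<a + p] @ [a + p + d..<j' + d]"
        using False i' by simp
      finally have "map x (filter (\<lambda>q. q \<in> kept f) [i'..<j' + d])
          = map x [i'..<a + p] @ map x [a + p + d..<j' + d]"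
        by simp
      also have "map x [a + p + d..<j' + d] = map x [a + p..<j']"
      proof (rule nth_equalityI)
        fix r assume "r < length (map x [a + p + d..<j' + d])"
        then have "r < j' - (a + p)" by simp
        then show "map x [a + p + d..<j' + d] ! r = map x [a + p..<j'] ! r"
          using block_shift[OF ac(2), of "a + p + r" n] n j'c by (simp add: algebra_simps)
      qed simp
      also have "map x [i'..<a + p] @ map x [a + p..<j'] = t"
        using False i' subsequence_split[of i' "a + p" j' x]
        unfolding t_eq[symmetric] subsequence_def by simp
      finally show ?thesis
        using map_kept[of f i' "j' + d"] unfolding factors_def by auto
    qed
  qed
qed

section \<open>Palindromic length of the shortened word\<close>

text \<open>The reflection sends the pair \<open>i\<close>, \<open>i + p\<close> to a pair at
  distance \<open>p\<close>, so breaks go to breaks and \<open>u\<close> to \<open>rev u\<close>.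
  The strict bounds keep the breaks on both sides of the block inside the palindrome.\<close>

lemma long_block_mirror:
  assumes pal: "\<And>i. s \<le> i \<Longrightarrow> i < t \<Longrightarrow> x (s + t - 1 - i) = x i"
    and ac: "long_block a c" "s < a" "c + p < t"
  shows "long_block (s + t - p - c) (s + t - p - a)"
proof -
  have ag: "agree (s + t - 1 - p - i) \<longleftrightarrow> agree i" if "s \<le> i" "i + p < t" for i
  proof -
    have "s + t - 1 - p - i + p = s + t - 1 - i" "s + t - 1 - p - i = s + t - 1 - (i + p)"
      using that by auto
    then show ?thesis
      using pal[of i] pal[of "i + p"] that unfolding agree_def by auto
  qed
  have bl: "a < c" "\<And>i. a \<le> i \<Longrightarrow> i < c \<Longrightarrow> agree i" "\<not> agree c" "\<not> agree (a - 1)"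
    using ac unfolding long_block_def block_def by auto
  have "agree i" if "s + t - p - c \<le> i" "i < s + t - p - a" for i
  proof -
    have "s + t - 1 - p - (s + t - 1 - p - i) = i" using that by auto
    then show ?thesis
      using ag[of "s + t - 1 - p - i"] bl(2)[of "s + t - 1 - p - i"] that ac by auto
  qed
  moreover have "\<not> agree (s + t - p - a)"
  proof -
    have "s + t - p - a = s + t - 1 - p - (a - 1)" using ac bl by auto
    then show ?thesis using ag[of "a - 1"] bl ac by auto
  qed
  moreover have "\<not> agree (s + t - p - c - 1)"
  proof -
    have "s + t - p - c - 1 = s + t - 1 - p - c" using ac bl by auto
    then show ?thesis using ag[of c] bl ac by auto
  qed
  ultimately have "block (s + t - p - c) (s + t - p - a)"
    using bl(1) ac unfolding block_def by auto
  moreover have "3 * p \<le> (s + t - p - a) - (s + t - p - c)"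
    using ac bl(1) unfolding long_block_def by auto
  moreover obtain m where m: "a \<le> m" "m \<le> c" "subsequence x m (m + p) \<in> {u, rev u}"
    using ac(1) unfolding long_block_def by auto
  have "subsequence x (s + t - p - m) (s + t - p - m + p) = rev (subsequence x m (m + p))"
  proof (rule nth_equalityI)
    fix r assume "r < length (subsequence x (s + t - p - m) (s + t - p - m + p))"
    then have r: "r < p" by simp
    have "s + t - p - m + r = s + t - 1 - (m + (p - Suc r))" using r m ac by auto
    then show "subsequence x (s + t - p - m) (s + t - p - m + p) ! r
        = rev (subsequence x m (m + p)) ! r"
      using r pal[of "m + (p - Suc r)"] m ac by (simp add: rev_nth)
  qed simp
  then have "\<exists>m\<in>{s + t - p - c..s + t - p - a}. subsequence x m (m + p) \<in> {u, rev u}"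
    using m by (intro bexI[of _ "s + t - p - m"]) auto
  ultimately show ?thesis
    unfolding long_block_def by blast
qed

text \<open>Reading \<open>w\<close> backwards deletes, in each block, the mirror image of another
  block's deleted part. Both deletions take \<open>d\<close> letters, a multiple of
  \<open>p\<close>, out of the same run, so the remaining words coincide.\<close>

lemma shortened_core_palindromic:
  fixes f :: "nat set"
  assumes pal: "\<And>i. s \<le> i \<Longrightarrow> i < t \<Longrightarrow> x (s + t - 1 - i) = x i"
    and br: "\<not> agree s" "\<not> agree (t - 1 - p)" "s + p < t"
  defines "w \<equiv> map x (filter (\<lambda>q. q \<in> kept f) [s..<t])"
  shows "w = rev w"
proof -
  define K where "K = (\<lambda>q. q \<in> kept f)"
  define K' where "K' = (\<lambda>q. s + t - 1 - q \<in> kept f)"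
  \<comment> \<open>The breaks at both ends of the core prevent a block with a deleted part in it
    from sticking out.\<close>
  have inner: "s < a" "c + p < t"
    if "block a c" "a + p \<le> q" "q < c" "s \<le> q" "q < t" for a c q
  proof -
    have "\<not> (a \<le> s \<and> s < c)" "\<not> (a \<le> t - 1 - p \<and> t - 1 - p < c)"
      using that(1) br unfolding block_def by auto
    then show "s < a" "c + p < t" using that br(3) by auto
  qed
  \<comment> \<open>Proved from right to left, one block or one position at a time; the third
    condition keeps \<open>i\<close> from falling into the interior of a long block.\<close>
  have K: "map x (filter K [i..<t]) = map x (filter K' [i..<t])"
    if "s \<le> i" "i \<le> t" "\<And>a c. long_block a c \<Longrightarrow> s < a \<Longrightarrow> c + p < t \<Longrightarrow> \<not> (a < i \<and> i < c)" for i
    using that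
  proof (induction "t - i" arbitrary: i rule: less_induct)
    case less
    consider "i = t" | "i < t" "\<exists>c. long_block i c \<and> s < i \<and> c + p < t"
      | "i < t" "\<nexists>c. long_block i c \<and> s < i \<and> c + p < t"
      using le_neq_implies_less[OF less.prems(2)] by blast
    then show ?case
    proof cases
      case 2
      then obtain c where c: "long_block i c" "s < i" "c + p < t" by blast
      then have bl: "block i c" "i < c" unfolding long_block_def block_def by auto
      define d where "d = cut f (c - i)"
      obtain n where n: "d = n * p" "i + d + red f (c - i) = c" "2 * p \<le> red f (c - i)"
        unfolding d_def by (rule long_block_cut[OF c(1), of f]) blast
      define a' where "a' = s + t - p - c"
      define c' where "c' = s + t - p - i"
      have mir: "long_block a' c'"
        unfolding a'_def c'_def using long_block_mirror[OF pal c] .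
      then have bl': "block a' c'" by (simp add: long_block_def)
      have d': "cut f (c' - a') = d"
        unfolding d_def a'_def c'_def using bl(2) c(3) by (intro arg_cong[of _ _ "cut f"]) auto
      have "filter K [i..<c] = [i..<min c (i + p)] @ [max i (i + p + d)..<c]"
        unfolding K_def by (rule filter_upt_gap)
          (use del_in_block[OF bl(1), of _ f] c(1) in \<open>auto simp: d_def\<close>)
      then have fK: "filter K [i..<c] = [i..<i + p] @ [i + p + d..<c]"
        using n by simp
      \<comment> \<open>Seen through the mirror, the deleted part is the last \<open>d\<close>
        positions of the block.\<close>
      have "filter K' [i..<c] = [i..<min c (c - d)] @ [max i c..<c]"
      proof (rule filter_upt_gap)
        fix q assume q: "i \<le> q" "q < c"
        show "K' q \<longleftrightarrow> \<not> (c - d \<le> q \<and> q < c)"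
        proof (cases "s + t - 1 - q < c'")
          case True
          have "a' \<le> s + t - 1 - q"
            using q c by (auto simp: a'_def)
          then have "K' q \<longleftrightarrow> \<not> (a' + p \<le> s + t - 1 - q \<and> s + t - 1 - q < a' + p + d)"
            using del_in_block[OF bl' _ True, of f] mir unfolding K'_def d' by simp
          moreover have a'p: "a' + p = s + t - c"
            using c(3) by (simp add: a'_def)
          moreover have "a' + p \<le> s + t - 1 - q" "s + t - 1 - q < a' + p + d \<longleftrightarrow> c - d \<le> q"
            using a'p q c(2,3) by auto
          ultimately show ?thesis
            using q by simp
        next
          case False
          have "s + t - 1 - q \<notin> del f"
          proof
            assume "s + t - 1 - q \<in> del f"
            then obtain a2 c2 where ac2: "block a2 c2" "a2 + p \<le> s + t - 1 - q"
              "s + t - 1 - q + p < c2"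
              by (rule delE)
            have "a' \<noteq> a2"
              using block_unique(2)[OF bl' ac2(1), of a'] bl' ac2(1,3) False by (auto simp: block_def)
            moreover have "\<not> a2 < a'"
              using block_before[OF ac2(1) bl'] bl' ac2(3) False by (auto simp: block_def)
            ultimately have "c' < a2"
              using block_before[OF bl' ac2(1)] by simp
            then show False
              using ac2(2) q c unfolding c'_def by linarith
          qed
          then show ?thesis
            using False q n c unfolding K'_def c'_def by auto
        qed
      qed simp
      then have fK': "filter K' [i..<c] = [i..<c - d]"
        using bl(2) by simp
      have "map x [i + p + d..<c] = map x [i + p..<c - d]"
      proof (rule nth_equalityI)
        fix r assume "r < length (map x [i + p + d..<c])"
        then have "r < c - (i + p + d)" by simp
        then show "map x [i + p + d..<c] ! r = map x [i + p..<c - d] ! r"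
          using block_shift[OF bl(1), of "i + p + r" n] n by (simp add: algebra_simps)
      qed simp
      moreover have "[i..<c - d] = [i..<i + p] @ [i + p..<c - d]"
        using n by (intro upt_split) auto
      ultimately have "map x (filter K [i..<c]) = map x (filter K' [i..<c])"
        unfolding fK fK' by simp
      moreover have "map x (filter K [c..<t]) = map x (filter K' [c..<t])"
      proof (rule less.hyps)
        show "t - c < t - i" "s \<le> c" "c \<le> t" using bl c by auto
        show "\<not> (a2 < c \<and> c < c2)" if "long_block a2 c2" "s < a2" "c2 + p < t" for a2 c2
          using that(1) bl(1) unfolding long_block_def block_def by auto
      qed
      moreover have "[i..<t] = [i..<c] @ [c..<t]"
        using bl c by (intro upt_split) auto
      ultimately show ?thesis
        by (simp del: upt_Suc)
    next
      case 3
      have not_in: "\<not> (a \<le> i \<and> i < c)" if "long_block a c" "s < a" "c + p < t" for a c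
        using less.prems(3)[OF that] 3(2) that by (cases "a = i") auto
      have "K i"
      proof (rule ccontr)
        assume "\<not> K i"
        then have "i \<in> del f" by (simp add: K_def)
        then obtain a c where ac: "long_block a c" "block a c" "a + p \<le> i" "i + p < c"
          by (rule delE)
        then show False
          using inner[OF ac(2,3)] not_in[OF ac(1)] less.prems 3(1) by auto
      qed
      moreover have "K' i"
      proof (rule ccontr)
        assume "\<not> K' i"
        then have "s + t - 1 - i \<in> del f" by (simp add: K'_def)
        then obtain a c where ac: "long_block a c" "block a c" "a + p \<le> s + t - 1 - i"
            "s + t - 1 - i + p < c"
          by (rule delE)
        have inn: "s < a" "c + p < t"
          using inner[OF ac(2,3)] ac(4) less.prems 3(1) by auto
        have "a < c" using ac(2) by (simp add: block_def)
        then have "s < s + t - p - c" "s + t - p - a + p < t" "s + t - p - c \<le> i" "i < s + t - p - a"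
          using inn ac(3,4) 3(1) less.prems(1) by linarith+
        then show False
          using not_in[OF long_block_mirror[OF pal ac(1) inn]] by blast
      qed
      moreover have "map x (filter K [Suc i..<t]) = map x (filter K' [Suc i..<t])"
      proof (rule less.hyps)
        show "t - Suc i < t - i" "s \<le> Suc i" "Suc i \<le> t" using 3 less.prems by auto
        show "\<not> (a < Suc i \<and> Suc i < c)" if "long_block a c" "s < a" "c + p < t" for a c
          using not_in[OF that] by auto
      qed
      ultimately show ?thesis
        using 3(1) by (simp add: upt_conv_Cons del: upt_Suc)
    qed simp
  qed
  have "rev w = map x (filter K (rev [s..<t]))"
    unfolding w_def K_def by (simp add: rev_map rev_filter)
  also have "rev [s..<t] = map (\<lambda>q. s + t - 1 - q) [s..<t]"
    by (rule nth_equalityI) (auto simp: rev_nth)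
  also have "map x (filter K (map (\<lambda>q. s + t - 1 - q) [s..<t]))
      = map (\<lambda>q. x (s + t - 1 - q)) (filter K' [s..<t])"
    unfolding filter_map K_def K'_def by (simp add: comp_def)
  also have "\<dots> = map x (filter K' [s..<t])"
    using pal by (intro map_cong) auto
  also have "\<dots> = map x (filter K [s..<t])"
    by (rule K[symmetric]) (use br in auto)
  finally show ?thesis
    unfolding w_def K_def by simp
qed

text \<open>Deleted parts of two blocks would have a break between them, more than \<open>p\<close>
  before \<open>t\<close>, which the period excludes. So one gap at most is cut out and at most two
  factors of \<open>x\<close> remain.\<close>

lemma PL_shortened_run:
  assumes k: "\<And>t. t \<in> factors x \<Longrightarrow> PL t \<le> k"
    and run: "\<And>i. s \<le> i \<Longrightarrow> i + p < t \<Longrightarrow> agree i"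
  shows "PL (map x (filter (\<lambda>q. q \<in> kept f) [s..<t])) \<le> 2 * k"
proof -
  have fac: "PL (map x [i..<j]) \<le> k" for i j
    by (rule k) (auto simp: factors_def subsequence_def)
  have "\<exists>l r. l \<le> r \<and> (\<forall>q. s \<le> q \<longrightarrow> q < t \<longrightarrow> (q \<in> kept f \<longleftrightarrow> \<not> (l \<le> q \<and> q < r)))"
  proof (cases "\<exists>q\<in>del f. s \<le> q \<and> q < t")
    case True
    then obtain q where q: "q \<in> del f" "s \<le> q" "q < t" by blast
    obtain a c where ac: "long_block a c" "block a c" "a + p \<le> q" "q < a + p + cut f (c - a)"
      "q + p < c"
      using q(1) by (rule delE)
    have close: False
      if "block a c" "q < c" "s \<le> q" "block a' c'" "a' + p \<le> q'" "q' < t" "a < a'" for a c a' c' q q'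
      using block_before[OF that(1,4,7)] run[of c] that by (auto simp: block_def)
    have "q' \<in> kept f \<longleftrightarrow> \<not> (a + p \<le> q' \<and> q' < a + p + cut f (c - a))"
      if "s \<le> q'" "q' < t" for q'
    proof
      assume "q' \<in> kept f"
      then show "\<not> (a + p \<le> q' \<and> q' < a + p + cut f (c - a))"
        using ac(1) unfolding del_def by auto
    next
      assume out: "\<not> (a + p \<le> q' \<and> q' < a + p + cut f (c - a))"
      show "q' \<in> kept f"
      proof
        assume "q' \<in> del f"
        then obtain a' c' where ac': "block a' c'" "a' + p \<le> q'" "q' < a' + p + cut f (c' - a')"
            "q' + p < c'"
          by (rule delE)
        have "a = a'"
          using close[OF ac(2) _ q(2) ac'(1,2) that(2)] close[OF ac'(1) _ that(1) ac(2,3) q(3)]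
            ac ac' by (metis add_lessD1 linorder_neqE_nat)
        moreover from this have "c = c'"
          using block_unique(2)[OF ac(2) ac'(1), of a] ac(2) ac'(1) by (simp add: block_def)
        ultimately show False using out ac' by simp
      qed
    qed
    then show ?thesis by (intro exI[of _ "a + p"] exI[of _ "a + p + cut f (c - a)"]) auto
  qed (auto intro!: exI[of _ 0])
  then obtain l r where "l \<le> r" "\<And>q. s \<le> q \<Longrightarrow> q < t \<Longrightarrow> q \<in> kept f \<longleftrightarrow> \<not> (l \<le> q \<and> q < r)"
    by blast
  then have "filter (\<lambda>q. q \<in> kept f) [s..<t] = [s..<min t l] @ [max s r..<t]"
    by (intro filter_upt_gap) auto
  then show ?thesis
    using PL_append[of "map x [s..<min t l]" "map x [max s r..<t]"] fac[of s "min t l"]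
      fac[of "max s r" t] by simp
qed

text \<open>Cutting at the first break \<open>b\<close> and its mirror image \<open>b'\<close>
  leaves two outer parts of period \<open>p\<close>, worth \<open>2 * k\<close> each, and a core
  that contributes one palindrome.\<close>

lemma PL_shortened_palindrome:
  assumes k: "\<And>t. t \<in> factors x \<Longrightarrow> PL t \<le> k"
    and st: "s \<le> t" "map x [s..<t] = rev (map x [s..<t])"
  shows "PL (map x (filter (\<lambda>q. q \<in> kept f) [s..<t])) \<le> 4 * k + 1"
proof (cases "\<forall>i. s \<le> i \<longrightarrow> i + p < t \<longrightarrow> agree i")
  case True
  then show ?thesis
    using PL_shortened_run[OF k, of s t f] by force
next
  case False
  have pal: "x (s + t - 1 - i) = x i" if "s \<le> i" "i < t" for i
  proof -
    have "map x [s..<t] ! (i - s) = rev (map x [s..<t]) ! (i - s)"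
      using st(2) by simp
    then show ?thesis using that by (simp add: rev_nth algebra_simps)
  qed
  have ag: "agree (s + t - 1 - p - i) \<longleftrightarrow> agree i" if "s \<le> i" "i + p < t" for i
  proof -
    have "s + t - 1 - p - i + p = s + t - 1 - i" "s + t - 1 - p - i = s + t - 1 - (i + p)"
      using that by auto
    then show ?thesis
      using pal[of i] pal[of "i + p"] that unfolding agree_def by auto
  qed
  define b where "b = (LEAST i. s \<le> i \<and> i + p < t \<and> \<not> agree i)"
  have b: "s \<le> b" "b + p < t" "\<not> agree b"
    using LeastI_ex[of "\<lambda>i. s \<le> i \<and> i + p < t \<and> \<not> agree i"] False unfolding b_def by blast+
  have before_b: "agree i" if "s \<le> i" "i < b" for i
    using not_less_Least[of i "\<lambda>i. s \<le> i \<and> i + p < t \<and> \<not> agree i"] that b(2)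
    unfolding b_def by auto
  define b' where "b' = s + t - b"
  have br': "\<not> agree (b' - 1 - p)"
    using ag[of b] b by (simp add: b'_def algebra_simps)
  have after_b': "agree i" if "b' \<le> i + p" "i + p < t" for i
    using ag[of "s + t - 1 - p - i"] before_b[of "s + t - 1 - p - i"] that b
    by (simp add: b'_def)
  have bb': "b + p < b'"
  proof (rule ccontr)
    assume "\<not> b + p < b'"
    then have "agree b" using b by (intro after_b') auto
    then show False using b by simp
  qed
  have b't: "b' \<le> t" using b by (simp add: b'_def)
  have "PL (map x (filter (\<lambda>q. q \<in> kept f) [s..<b])) \<le> 2 * k"
    by (rule PL_shortened_run[OF k]) (use before_b in auto)
  moreover have "PL (map x (filter (\<lambda>q. q \<in> kept f) [b'..<t])) \<le> 2 * k"
    by (rule PL_shortened_run[OF k]) (use after_b' in auto)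
  moreover have "PL (map x (filter (\<lambda>q. q \<in> kept f) [b..<b'])) \<le> 1"
  proof (rule PL_rev_eq, rule shortened_core_palindromic)
    show "x (b + b' - 1 - i) = x i" if "b \<le> i" "i < b'" for i
    proof -
      have "b + b' = s + t" using b by (simp add: b'_def)
      then show ?thesis using pal[of i] that b b't by simp
    qed
  qed (use b br' bb' in auto)
  moreover have "[s..<t] = [s..<b] @ [b..<b'] @ [b'..<t]"
    using upt_split[of s b t] upt_split[of b b' t] b bb' b't by simp
  ultimately show ?thesis
    using PL_append[of "map x (filter (\<lambda>q. q \<in> kept f) [s..<b])"
        "map x (filter (\<lambda>q. q \<in> kept f) ([b..<b'] @ [b'..<t]))"]
      PL_append[of "map x (filter (\<lambda>q. q \<in> kept f) [b..<b'])"
        "map x (filter (\<lambda>q. q \<in> kept f) [b'..<t])"]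
    by simp
qed

lemma PL_shortened_concat:
  assumes k: "\<And>t. t \<in> factors x \<Longrightarrow> PL t \<le> k"
    and "s \<le> t" "map x [s..<t] = concat vs" "\<forall>v\<in>set vs. palindrome v"
  shows "PL (map x (filter (\<lambda>q. q \<in> kept f) [s..<t])) \<le> length vs * (4 * k + 1)"
  using assms(2-)
proof (induction vs arbitrary: s)
  case (Cons v vs)
  define r where "r = s + length v"
  have "length (map x [s..<t]) = length (v @ concat vs)"
    using Cons.prems by simp
  then have r: "s \<le> r" "r \<le> t"
    using Cons.prems(1) by (auto simp: r_def)
  then have split: "[s..<t] = [s..<r] @ [r..<t]"
    by (rule upt_split)
  then have "map x [s..<r] @ map x [r..<t] = v @ concat vs"
    using Cons.prems(2) by simp
  then have eq: "map x [s..<r] = v" "map x [r..<t] = concat vs"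
    by (auto simp: r_def append_eq_append_conv)
  have "PL (map x (filter (\<lambda>q. q \<in> kept f) [s..<r])) \<le> 4 * k + 1"
    by (rule PL_shortened_palindrome[OF k r(1)]) (use Cons.prems(3) eq(1) in \<open>auto simp: palindrome_def\<close>)
  moreover have "PL (map x (filter (\<lambda>q. q \<in> kept f) [r..<t])) \<le> length vs * (4 * k + 1)"
    using Cons.IH[OF r(2) eq(2)] Cons.prems(3) by simp
  ultimately show ?case
    using PL_append[of "map x (filter (\<lambda>q. q \<in> kept f) [s..<r])"
        "map x (filter (\<lambda>q. q \<in> kept f) [r..<t])"] split
    by simp
qed auto

text \<open>The factor is what remains of an interval of \<open>x\<close>, which splits into at most
  \<open>k\<close> palindromes.\<close>

lemma PL_short_factor:
  assumes k: "\<And>t. t \<in> factors x \<Longrightarrow> PL t \<le> k" and t: "t \<in> factors (short f)"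
  shows "PL t \<le> k * (4 * k + 1)"
proof -
  obtain i j where ij: "t = subsequence (short f) i j"
    using t unfolding factors_def by blast
  show ?thesis
  proof (cases "i \<le> j")
    case True
    then have le: "pos f i \<le> pos f j"
      using pos_less_iff[of f j i] by simp
    obtain vs where vs: "length vs = PL (map x [pos f i..<pos f j])"
      "map x [pos f i..<pos f j] = concat vs" "\<forall>v\<in>set vs. palindrome v"
      by (rule PL_attained)
    have "PL t \<le> length vs * (4 * k + 1)"
      using PL_shortened_concat[OF k le vs(2,3), of f] map_kept[of f "pos f i" "pos f j"] ij by simp
    moreover have "length vs \<le> k"
      using k[of "map x [pos f i..<pos f j]"] vs(1) by (auto simp: factors_def subsequence_def)
    ultimately show ?thesis
      by (meson le_trans mult_le_mono1)
  qed (use ij in \<open>simp add: subsequence_def\<close>)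
qed

end

theorem theorem1p4:
  fixes A :: "'a set" and x :: "'a word" and u :: "'a list" and k :: nat
  assumes "finite A"
    and "range x \<subseteq> A"
    and "\<not> ultimately_periodic x"
    and "u \<in> factors x"
    and "length u \<ge> 1"
    and "primitive u"
    and "recurrent_in (word_power u 5) x"
    and "k \<ge> 1"
    and "maxPL x \<le> enat k"
  shows "\<exists>y :: 'a word. range y \<subseteq> A \<and> \<not> ultimately_periodic y \<and>
           word_power u 5 \<notin> factors y \<and>
           word_power (rev u) 5 \<notin> factors y \<and>
           Psi x u \<subseteq> factors y \<and>
           maxPL y \<le> enat (3 * k ^ 3)"
proof -
  interpret word_runs x u
  proof
    show "u \<noteq> []" using assms(5) by auto
    show "infinite {i. x i \<noteq> x (i + length u)}"
    proof
      assume "finite {i. x i \<noteq> x (i + length u)}"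
      then obtain n where "\<forall>i\<in>{i. x i \<noteq> x (i + length u)}. i < n"
        using finite_nat_set_iff_bounded by blast
      then have "ultimately_periodic x"
        using assms(5) by (intro ultimately_periodicI[of "length u" n]) auto
      then show False using assms(3) by simp
    qed
  qed
  have PLx: "PL t \<le> k" if "t \<in> factors x" for t
    using assms(9) that unfolding maxPL_le_iff by (cases "t = []") auto
  have "k \<noteq> 1"
  proof
    assume k: "k = 1"
    have "x i = x (i + 1)" for i
    proof -
      have "[x i, x (Suc i)] = subsequence x i (Suc (Suc i))"
        by (simp add: subsequence_def)
      then have "PL [x i, x (Suc i)] \<le> 1"
        using PLx k unfolding factors_def by blast
      moreover obtain vs where vs: "length vs = PL [x i, x (Suc i)]" "[x i, x (Suc i)] = concat vs"
        "\<forall>p\<in>set vs. palindrome p"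
        by (rule PL_attained)
      ultimately have "length vs \<le> 1" by simp
      then have "palindrome [x i, x (Suc i)]"
        using vs(2,3) by (cases vs) auto
      then have "hd [x i, x (Suc i)] = hd (rev [x i, x (Suc i)])"
        unfolding palindrome_def by metis
      then show ?thesis by simp
    qed
    then have "ultimately_periodic x"
      by (intro ultimately_periodicI[of 1 0]) auto
    then show False using assms(3) by simp
  qed
  then have "2 \<le> k" using assms(8) by simp
  \<comment> \<open>After the substitution, the bound compares polynomials in \<open>j\<close> with
    nonnegative coefficients.\<close>
  then obtain j where "k = j + 2"
    using le_Suc_ex by (metis add.commute)
  then have bound: "k * (4 * k + 1) \<le> 3 * k ^ 3"
    by (simp add: power3_eq_cube algebra_simps)
  obtain f where f: "\<not> ultimately_periodic (short f)"
    using short_not_ultimately_periodic assms(1-3) finite_subset by blast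
  have "maxPL (short f) \<le> enat (3 * k ^ 3)"
    unfolding maxPL_le_iff using PL_short_factor[of k _ f] PLx bound by (meson le_trans)
  moreover have "range (short f) \<subseteq> A"
    using assms(2) by (auto simp: short_def)
  moreover have "Psi x u \<subseteq> factors (short f)"
    using factor_preserved by blast
  ultimately show ?thesis
    using f fifth_power_not_in_short[of u f] fifth_power_not_in_short[of "rev u" f]
    by (intro exI[of _ "short f"]) simp
qed

end
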